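(* Let $L_x\ge 0$, $s>0$, and $\mathcal J:=\{0,1,\dots,\lfloor L_x/s\rfloor\}$. For each $m\in\mathcal J$ let $h_m$ be the partial harness with $m$ scaffolded stages of length $s$ followed by an autonomous tail of residual length $L_x-ms$. Assume the positive homogeneous slice factorization and the convex tail risk condition stated in the context, with scaffold cost $c_s=-\log q_{\mathrm{scaf}}(s;M)$ and tail risk $\kappa_{\mathrm{tail}}(d;M)=-\log q_{\mathrm{tail}}(d;M)$. Let $$F(m):=-\log\Pr\nolimits_{h_m}\left(\mathrm{Succ}_x(\tau_h)\mid x\right),\quad m\in\mathcal J,$$ $$\Delta(m;M):=\kappa_{\mathrm{tail}}(L_x-ms;M)-\kappa_{\mathrm{tail}}(L_x-(m+1)s;M),\quad m,m+1\in\mathcal J.$$ Then: (1) $F$ is discrete-convex on $\mathcal J$ (its forward differences $F(m+1)-F(m)$ are nondecreasing in $m$), and the success probability $\exp(-F(m))$ is log-concave and unimodal over $m\in\mathcal J$. (2) The smallest maximizer of $\exp(-F(m))$ over $\mathcal J$ is $$m_{\mathrm{peak}}=\min\{m\in\mathcal J:\ m+1\in\mathcal J,\ \Delta(m;M)\le c_s\},$$ with $m_{\mathrm{peak}}=\max\mathcal J$ if this set is empty. (3) For $\alpha\in(0,1)$, the smallest $m\in\mathcal J$ for which the success probability of $h_m$ is at least $\alpha$ is $$m_\alpha=\min\{m\in\mathcal J:\ F(m)\le-\log\alpha\}$$ whenever this set is nonempty.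
   Context: Task $x$ has total latent progress demand $L_x$. For $m\in\mathcal J$, $\Pr_{h_m}(\cdot\mid x)$ is the law of the execution under $h_m$; $A_t^{(m)}$ ($t=1,\dots,m$) is the event that the $t$-th scaffolded stage preserves recoverability, $A_{<t}^{(m)}:=\bigcap_{r<t}A_r^{(m)}$ (the sure event for $t=1$), $A_{\mathrm{tail}}^{(m)}$ is the event that the autonomous tail succeeds, and $\mathrm{Succ}_x(\tau_h)$ is the event that the final answer is correct. $M$ is a fixed per-stage attempt budget, entering only as a parameter. Positive homogeneous slice factorization: there exist scalars $q_{\mathrm{scaf}}(s;M)\in(0,1]$ and $q_{\mathrm{tail}}(L_x-ms;M)\in(0,1]$, with $q_{\mathrm{tail}}(0;M)=1$, such that for every $m\in\mathcal J$: (i) $\mathrm{Succ}_x(\tau_h)=\bigcap_{t=1}^m A_t^{(m)}\cap A_{\mathrm{tail}}^{(m)}$; (ii) $\Pr_{h_m}(A_t^{(m)}\mid A_{<t}^{(m)},x)=q_{\mathrm{scaf}}(s;M)$ for $t=1,\dots,m$; (iii) $\Pr_{h_m}(A_{\mathrm{tail}}^{(m)}\mid A_1^{(m)},\dots,A_m^{(m)},x)=q_{\mathrm{tail}}(L_x-ms;M)$. Convex tail risk: on the grid $\{L_x-ms:m\in\mathcal J\}$, the function $d\mapsto\kappa_{\mathrm{tail}}(d;M)$ is finite, nondecreasing and convex (the increments $\kappa_{\mathrm{tail}}(d;M)-\kappa_{\mathrm{tail}}(d-s;M)$ are nondecreasing in $d$ along the grid), with $\kappa_{\mathrm{tail}}(0;M)=0$.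 *)

theory Defs
  imports "HOL-Probability.Probability"
begin

record partial_harness =
  scaffold_stages :: nat
  stage_length :: real
  tail_length :: real

definition harness :: "real \<Rightarrow> real \<Rightarrow> nat \<Rightarrow> partial_harness" where
  "harness Lx s m = \<lparr> scaffold_stages = m, stage_length = s, tail_length = Lx - real m * s \<rparr>"

definition stage_counts :: "real \<Rightarrow> real \<Rightarrow> nat set" where
  "stage_counts Lx s = {0..nat \<lfloor>Lx / s\<rfloor>}"

(* Here P m is the law of the execution under the m-stage harness on the fixed task, and
   Succ m, A m t, Atail m are events of it; different m may live on different sample spaces.
   Since x / 0 = 0, the requirement that the conditional probabilities be positive
   already forces every conditioning event below to have positive probability.
   For t = 1 (resp. m = 0) the condition is vacuous, i.e. one conditions on the sure event. *)
definition positive_homogeneous_slice_factorization ::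
  "real \<Rightarrow> real \<Rightarrow> (nat \<Rightarrow> 'w measure) \<Rightarrow> (nat \<Rightarrow> 'w set) \<Rightarrow> (nat \<Rightarrow> nat \<Rightarrow> 'w set) \<Rightarrow> (nat \<Rightarrow> 'w set)
     \<Rightarrow> (real \<Rightarrow> 'b \<Rightarrow> real) \<Rightarrow> (real \<Rightarrow> 'b \<Rightarrow> real) \<Rightarrow> 'b \<Rightarrow> bool" where
  "positive_homogeneous_slice_factorization Lx s P Succ A Atail q_scaf q_tail M \<longleftrightarrow>
     q_scaf s M \<in> {0<..1} \<and>
     q_tail 0 M = 1 \<and>
     (\<forall>m\<in>stage_counts Lx s.
        q_tail (Lx - real m * s) M \<in> {0<..1} \<and>
        Succ m = (\<Inter>t\<in>{1..m}. A m t) \<inter> Atail m \<and>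
        (\<forall>t\<in>{1..m}. \<P>(\<omega> in P m. \<omega> \<in> A m t \<bar> \<forall>r\<in>{1..<t}. \<omega> \<in> A m r) = q_scaf s M) \<and>
        \<P>(\<omega> in P m. \<omega> \<in> Atail m \<bar> \<forall>r\<in>{1..m}. \<omega> \<in> A m r) = q_tail (Lx - real m * s) M)"

definition tail_risk :: "(real \<Rightarrow> 'b \<Rightarrow> real) \<Rightarrow> real \<Rightarrow> 'b \<Rightarrow> real" where
  "tail_risk q_tail d M = - ln (q_tail d M)"

definition residual_grid :: "real \<Rightarrow> real \<Rightarrow> real set" where
  "residual_grid Lx s = (\<lambda>m. Lx - real m * s) ` stage_counts Lx s"

(* Finiteness of the risk on the grid is built in: kappa is real-valued, and it is only used
   as tail_risk q_tail with q_tail positive on the grid. *)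
definition convex_tail_risk :: "real \<Rightarrow> real \<Rightarrow> (real \<Rightarrow> 'b \<Rightarrow> real) \<Rightarrow> 'b \<Rightarrow> bool" where
  "convex_tail_risk Lx s \<kappa> M \<longleftrightarrow>
     mono_on (residual_grid Lx s) (\<lambda>d. \<kappa> d M) \<and>
     mono_on {d \<in> residual_grid Lx s. d - s \<in> residual_grid Lx s} (\<lambda>d. \<kappa> d M - \<kappa> (d - s) M) \<and>
     \<kappa> 0 M = 0"

definition discrete_convex_on :: "nat set \<Rightarrow> (nat \<Rightarrow> real) \<Rightarrow> bool" where
  "discrete_convex_on J f \<longleftrightarrow> mono_on {m\<in>J. m + 1 \<in> J} (\<lambda>m. f (m + 1) - f m)"

definition log_concave_on :: "nat set \<Rightarrow> (nat \<Rightarrow> real) \<Rightarrow> bool" where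
  "log_concave_on J p \<longleftrightarrow>
     (\<forall>m\<in>J. 0 < p m) \<and>
     (\<forall>m. m \<in> J \<and> m + 1 \<in> J \<and> m + 2 \<in> J \<longrightarrow> p m * p (m + 2) \<le> (p (m + 1))\<^sup>2)"

definition unimodal_on :: "nat set \<Rightarrow> (nat \<Rightarrow> real) \<Rightarrow> bool" where
  "unimodal_on J p \<longleftrightarrow> (\<exists>k\<in>J. mono_on {m\<in>J. m \<le> k} p \<and> antimono_on {m\<in>J. k \<le> m} p)"

definition is_smallest :: "nat set \<Rightarrow> nat \<Rightarrow> bool" where
  "is_smallest S m \<longleftrightarrow> m \<in> S \<and> (\<forall>k\<in>S. m \<le> k)"

end

theory Submission
  imports Defs
begin

text \<open>
  The chain rule turns the slice factorization into
  $\Pr_{h_m}(\mathrm{Succ}) = q_{\mathrm{scaf}}^m\, q_{\mathrm{tail}}(L_x - ms)$, so that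
  $F(m) = m c_s + \kappa_{\mathrm{tail}}(L_x - ms)$ and $F(m+1) - F(m) = c_s - \Delta(m)$. Convexity of the tail
  risk makes $\Delta$ nonincreasing, hence $F$ convex. A convex $F$ strictly decreases up to the
  first $m$ with $\Delta(m) \le c_s$ and is nondecreasing from there on.
\<close>

text \<open>A null conditioning event does no harm: the joint event lies inside it, so both sides
  vanish. Hence the chain rule below can be run without tracking positivity of the conditioning
  events.\<close>

lemma (in prob_space) prob_conj_eq_cond_prob_mult:
  assumes "{\<omega> \<in> space M. Q \<omega>} \<in> events"
  shows "\<P>(\<omega> in M. R \<omega> \<and> Q \<omega>) = \<P>(\<omega> in M. R \<omega> \<bar> Q \<omega>) * \<P>(\<omega> in M. Q \<omega>)"
proof (cases "\<P>(\<omega> in M. Q \<omega>) = 0")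
  case True
  have "\<P>(\<omega> in M. R \<omega> \<and> Q \<omega>) \<le> \<P>(\<omega> in M. Q \<omega>)"
    by (intro finite_measure_mono assms) auto
  with True show ?thesis
    by (simp add: measure_le_0_iff)
qed (simp add: cond_prob_def)

text \<open>Chain rule: the last stage is split off by conditioning on all earlier ones, and the
  induction hypothesis evaluates what remains.\<close>

lemma (in prob_space) prob_Ball_eq_prod_cond_prob:
  fixes n :: nat
  assumes "\<And>t. t \<in> {1..n} \<Longrightarrow> A t \<in> events"
    and "\<And>t. t \<in> {1..n} \<Longrightarrow> \<P>(\<omega> in M. \<omega> \<in> A t \<bar> \<forall>r\<in>{1..<t}. \<omega> \<in> A r) = q t"
  shows "\<P>(\<omega> in M. \<forall>r\<in>{1..n}. \<omega> \<in> A r) = (\<Prod>t\<in>{1..n}. q t)"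
  using assms
proof (induction n)
  case 0
  then show ?case by (simp add: prob_space)
next
  case (Suc n)
  \<comment> \<open>The range stays \<open>{1..<Suc n}\<close> to match the event conditioned on at
    stage \<open>Suc n\<close>; it becomes \<open>{1..n}\<close> only to meet the induction
    hypothesis.\<close>
  have "{\<omega> \<in> space M. \<forall>r\<in>{1..<Suc n}. \<omega> \<in> A r} \<in> events"
    using Suc.prems(1) by (intro sets.sets_Collect_finite_All) (auto simp: Collect_conj_eq)
  from prob_conj_eq_cond_prob_mult[OF this, of "\<lambda>\<omega>. \<omega> \<in> A (Suc n)"]
  have "\<P>(\<omega> in M. \<omega> \<in> A (Suc n) \<and> (\<forall>r\<in>{1..<Suc n}. \<omega> \<in> A r))
      = q (Suc n) * \<P>(\<omega> in M. \<forall>r\<in>{1..<Suc n}. \<omega> \<in> A r)"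
    using Suc.prems(2)[of "Suc n"] by simp
  also have "\<P>(\<omega> in M. \<forall>r\<in>{1..<Suc n}. \<omega> \<in> A r) = (\<Prod>t\<in>{1..n}. q t)"
    using Suc by (simp add: atLeastLessThanSuc_atLeastAtMost)
  also have "{\<omega> \<in> space M. \<omega> \<in> A (Suc n) \<and> (\<forall>r\<in>{1..<Suc n}. \<omega> \<in> A r)}
      = {\<omega> \<in> space M. \<forall>r\<in>{1..Suc n}. \<omega> \<in> A r}"
    by (auto simp: atLeastAtMostSuc_conv atLeastLessThanSuc_atLeastAtMost)
  finally show ?case by (simp add: mult.commute)
qed

text \<open>The tail acts as one more conditional factor after the chain of \<open>m\<close> equal
  stage factors.\<close>

lemma success_prob_eq:
  assumes fact: "positive_homogeneous_slice_factorization Lx s P Succ A Atail q_scaf q_tail M"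
    and m: "m \<in> stage_counts Lx s"
    and prob: "prob_space (P m)"
    and A: "\<And>t. t \<in> {1..m} \<Longrightarrow> A m t \<in> sets (P m)"
    and Atail: "Atail m \<in> sets (P m)"
  shows "measure (P m) (Succ m) = q_scaf s M ^ m * q_tail (Lx - real m * s) M"
proof -
  interpret prob_space "P m" by (rule prob)
  let ?all = "\<lambda>\<omega>. \<forall>r\<in>{1..m}. \<omega> \<in> A m r"
  have ev: "{\<omega> \<in> space (P m). ?all \<omega>} \<in> events"
    using A by (intro sets.sets_Collect_finite_All) (auto simp: Collect_conj_eq)
  have "\<P>(\<omega> in P m. ?all \<omega>) = (\<Prod>t\<in>{1..m}. q_scaf s M)"
    using fact m A
    by (intro prob_Ball_eq_prod_cond_prob)
      (auto simp: positive_homogeneous_slice_factorization_def)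
  \<comment> \<open>For \<open>m = 0\<close> the intersection over stages is the whole type, so
    containment in the sample space is taken from \<open>Atail m\<close>.\<close>
  moreover have "Succ m = {\<omega> \<in> space (P m). \<omega> \<in> Atail m \<and> ?all \<omega>}"
    using fact m sets.sets_into_space[OF Atail]
    by (auto simp: positive_homogeneous_slice_factorization_def)
  moreover have "\<P>(\<omega> in P m. \<omega> \<in> Atail m \<bar> ?all \<omega>) = q_tail (Lx - real m * s) M"
    using fact m by (simp add: positive_homogeneous_slice_factorization_def)
  ultimately show ?thesis
    using prob_conj_eq_cond_prob_mult[OF ev, of "\<lambda>\<omega>. \<omega> \<in> Atail m"] by simp
qed

text \<open>More stages mean a shorter residual, so increments nondecreasing in the residual become
  decrements nonincreasing in the stage count.\<close>

lemma tail_risk_decrement_antimono: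
  assumes convex: "convex_tail_risk Lx s \<kappa> M" and s: "0 \<le> s"
    and "i \<le> j" "i + 1 \<in> stage_counts Lx s" "j + 1 \<in> stage_counts Lx s"
  shows "\<kappa> (Lx - real j * s) M - \<kappa> (Lx - real (j + 1) * s) M
       \<le> \<kappa> (Lx - real i * s) M - \<kappa> (Lx - real (i + 1) * s) M"
proof -
  let ?d = "\<lambda>m. Lx - real m * s" and ?G = "residual_grid Lx s"
  have shift: "?d m - s = ?d (m + 1)" for m
    by (simp add: algebra_simps)
  \<comment> \<open>Stage counts form an initial segment, so \<open>m + 1\<close> being admissible
    puts both residuals, for \<open>m\<close> and for \<open>m + 1\<close>, on the grid.\<close>
  have grid: "?d m \<in> {d \<in> ?G. d - s \<in> ?G}" if "m + 1 \<in> stage_counts Lx s" for m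
    using that unfolding mem_Collect_eq shift residual_grid_def
    by (intro conjI imageI) (auto simp: stage_counts_def)
  have "?d j \<le> ?d i"
    using s \<open>i \<le> j\<close> by (simp add: mult_right_mono)
  then have "\<kappa> (?d j) M - \<kappa> (?d j - s) M \<le> \<kappa> (?d i) M - \<kappa> (?d i - s) M"
    using convex assms(4,5) grid
    by (intro mono_onD[of "{d \<in> ?G. d - s \<in> ?G}" "\<lambda>d. \<kappa> d M - \<kappa> (d - s) M"])
      (auto simp: convex_tail_risk_def)
  then show ?thesis by (simp only: shift)
qed

text \<open>Two consecutive differences compare as 2 f(m+1) <= f(m) + f(m+2); negating and
  exponentiating turns sums into products.\<close>

lemma discrete_convex_on_imp_log_concave_on:
  assumes "discrete_convex_on J f"
  shows "log_concave_on J (\<lambda>m. exp (- f m))"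
  unfolding log_concave_on_def
proof (intro conjI ballI allI impI)
  fix m assume "m \<in> J \<and> m + 1 \<in> J \<and> m + 2 \<in> J"
  then have "f (m + 1) - f m \<le> f (m + 1 + 1) - f (m + 1)"
    using assms unfolding discrete_convex_on_def by (elim mono_onD) auto
  then have "exp (- f m + - f (m + 2)) \<le> exp (- f (m + 1) + - f (m + 1))"
    by simp
  then show "exp (- f m) * exp (- f (m + 2)) \<le> (exp (- f (m + 1)))\<^sup>2"
    unfolding exp_add by (simp add: power2_eq_square)
qed simp

text \<open>Strictness to the left of \<open>k\<close> comes from the minimality of \<open>k\<close>
  in \<open>S\<close>, and it is what later makes \<open>k\<close> the smallest minimizer, not just
  some minimizer. Convexity carries the nonnegative difference at \<open>k\<close> to all later
  indices.\<close>

lemma discrete_convex_on_valley: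
  fixes n :: nat and f :: "nat \<Rightarrow> real"
  assumes convex: "discrete_convex_on {0..n} f"
  defines "S \<equiv> {m \<in> {0..n}. m + 1 \<in> {0..n} \<and> f m \<le> f (m + 1)}"
  defines "k \<equiv> (if S = {} then n else Min S)"
  shows "k \<le> n"
    and "\<And>i j. i < j \<Longrightarrow> j \<le> k \<Longrightarrow> f j < f i"
    and "\<And>i j. k \<le> i \<Longrightarrow> i \<le> j \<Longrightarrow> j \<le> n \<Longrightarrow> f i \<le> f j"
proof -
  have fin: "finite S" by (simp add: S_def)
  then have S: "Min S \<in> S" if "S \<noteq> {}"
    using that by (rule Min_in)
  then show k: "k \<le> n"
    by (auto simp: k_def S_def)
  have down: "f (m + 1) < f m" if "m < k" for m
  proof -
    have "m \<notin> S"
      using that fin by (auto simp: k_def split: if_splits)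
    then show ?thesis
      using that k by (auto simp: S_def)
  qed
  have up: "f m \<le> f (m + 1)" if "k \<le> m" "m < n" for m
  proof -
    \<comment> \<open>An empty \<open>S\<close> would give \<open>k = n\<close>, contradicting
      \<open>k \<le> m < n\<close>.\<close>
    have "k \<in> S"
      using that S by (auto simp: k_def split: if_splits)
    then have "f k \<le> f (k + 1)"
      by (simp add: S_def)
    moreover have "f (k + 1) - f k \<le> f (m + 1) - f m"
      using convex that unfolding discrete_convex_on_def by (elim mono_onD) auto
    ultimately show ?thesis by simp
  qed
  show "f j < f i" if "i < j" "j \<le> k" for i j
    using that
  proof (induction rule: less_Suc_induct)
    case (1 i)
    then show ?case using down[of i] by simp
  next
    case (2 i l j)
    then show ?case by (meson less_imp_le_nat less_trans order_trans)
  qed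
  show "f i \<le> f j" if "k \<le> i" "i \<le> j" "j \<le> n" for i j
    using \<open>i \<le> j\<close> \<open>j \<le> n\<close>
  proof (induction rule: dec_induct)
    case (step l)
    then show ?case using up[of l] \<open>k \<le> i\<close> by simp
  qed simp
qed

theorem theorem3:
  fixes L :: "'x \<Rightarrow> real" and x :: 'x and s :: real and M :: nat
    and Pr :: "partial_harness \<Rightarrow> 'x \<Rightarrow> 'w measure"
    and Succ :: "'x \<Rightarrow> partial_harness \<Rightarrow> 'w set"
    and A :: "nat \<Rightarrow> nat \<Rightarrow> 'w set" and Atail :: "nat \<Rightarrow> 'w set"
    and q_scaf q_tail :: "real \<Rightarrow> nat \<Rightarrow> real"
    and J :: "nat set" and h :: "nat \<Rightarrow> partial_harness" and c\<^sub>s :: real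
    and \<kappa> :: "real \<Rightarrow> nat \<Rightarrow> real" and F :: "nat \<Rightarrow> real" and \<Delta> :: "nat \<Rightarrow> nat \<Rightarrow> real"
  assumes L_nonneg: "0 \<le> L x" and s_pos: "0 < s"
    and J_def: "J = stage_counts (L x) s"
    and h_def: "h = harness (L x) s"
    and prob: "\<And>m. m \<in> J \<Longrightarrow> prob_space (Pr (h m) x)"
    and A_event: "\<And>m t. m \<in> J \<Longrightarrow> t \<in> {1..m} \<Longrightarrow> A m t \<in> sets (Pr (h m) x)"
    and Atail_event: "\<And>m. m \<in> J \<Longrightarrow> Atail m \<in> sets (Pr (h m) x)"
    and factorization:
      "positive_homogeneous_slice_factorization (L x) s
         (\<lambda>m. Pr (h m) x) (\<lambda>m. Succ x (h m)) A Atail q_scaf q_tail M"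
    and c_def: "c\<^sub>s = - ln (q_scaf s M)"
    and \<kappa>_def: "\<kappa> = tail_risk q_tail"
    and convex_risk: "convex_tail_risk (L x) s \<kappa> M"
    and F_def: "F = (\<lambda>m. - ln (measure (Pr (h m) x) (Succ x (h m))))"
    and \<Delta>_def: "\<Delta> = (\<lambda>m M. \<kappa> (L x - real m * s) M - \<kappa> (L x - real (m + 1) * s) M)"
  shows
    "discrete_convex_on J F \<and>
     (\<forall>m\<in>J. exp (- F m) = measure (Pr (h m) x) (Succ x (h m))) \<and>
     log_concave_on J (\<lambda>m. exp (- F m)) \<and>
     unimodal_on J (\<lambda>m. exp (- F m)) \<and>
     (let S = {m\<in>J. m + 1 \<in> J \<and> \<Delta> m M \<le> c\<^sub>s};
          m_peak = (if S = {} then Max J else Min S)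
      in is_smallest {m\<in>J. \<forall>k\<in>J. exp (- F k) \<le> exp (- F m)} m_peak) \<and>
     (\<forall>\<alpha>\<in>{0<..<1}.
        let S = {m\<in>J. F m \<le> - ln \<alpha>}
        in S \<noteq> {} \<longrightarrow>
           is_smallest {m\<in>J. \<alpha> \<le> measure (Pr (h m) x) (Succ x (h m))} (Min S))"
proof -
  define n where "n = nat \<lfloor>L x / s\<rfloor>"
  have J: "J = {0..n}"
    by (simp add: J_def stage_counts_def n_def)
  have q_scaf: "0 < q_scaf s M"
    and q_tail: "\<And>m. m \<in> J \<Longrightarrow> 0 < q_tail (L x - real m * s) M"
    using factorization by (auto simp: positive_homogeneous_slice_factorization_def J_def)
  have succ: "measure (Pr (h m) x) (Succ x (h m)) = q_scaf s M ^ m * q_tail (L x - real m * s) M"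
    if "m \<in> J" for m
    using success_prob_eq[OF factorization that[unfolded J_def]] prob[OF that] A_event[OF that]
      Atail_event[OF that] by simp
  \<comment> \<open>Both factors are positive, so the exponential really undoes the logarithm in
    \<open>F\<close>.\<close>
  have succ_exp: "exp (- F m) = measure (Pr (h m) x) (Succ x (h m))" if "m \<in> J" for m
    using q_scaf q_tail[OF that] by (simp add: F_def succ[OF that])
  have F: "F m = real m * c\<^sub>s + \<kappa> (L x - real m * s) M" if "m \<in> J" for m
    using q_scaf q_tail[OF that]
    by (simp add: F_def succ[OF that] c_def \<kappa>_def tail_risk_def ln_mult ln_realpow)
  have diff: "F (m + 1) - F m = c\<^sub>s - \<Delta> m M" if "m \<in> J" "m + 1 \<in> J" for m
    using F[OF that(1)] F[OF that(2)] by (simp add: \<Delta>_def algebra_simps)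
  have convex: "discrete_convex_on J F"
    unfolding discrete_convex_on_def
  proof (rule mono_onI)
    fix i j assume ij: "i \<in> {m \<in> J. m + 1 \<in> J}" "j \<in> {m \<in> J. m + 1 \<in> J}" "i \<le> j"
    then have "\<Delta> j M \<le> \<Delta> i M"
      using tail_risk_decrement_antimono[OF convex_risk, of i j] s_pos
      by (simp add: J_def \<Delta>_def)
    with ij show "F (i + 1) - F i \<le> F (j + 1) - F j"
      using diff[of i] diff[of j] by simp
  qed
  define S where "S = {m \<in> J. m + 1 \<in> J \<and> \<Delta> m M \<le> c\<^sub>s}"
  define k where "k = (if S = {} then Max J else Min S)"
  \<comment> \<open>The peak condition says exactly that the forward difference of \<open>F\<close>
    is nonnegative, so the threshold set is the one used in the valley lemma.\<close>
  have S: "S = {m \<in> {0..n}. m + 1 \<in> {0..n} \<and> F m \<le> F (m + 1)}"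
  proof -
    have "\<Delta> m M \<le> c\<^sub>s \<longleftrightarrow> F m \<le> F (m + 1)" if "m \<in> J" "m + 1 \<in> J" for m
      using diff[OF that] by linarith
    then show ?thesis
      unfolding S_def J by blast
  qed
  have k: "k = (if S = {} then n else Min S)"
    by (auto simp: k_def J intro!: Max_eqI)
  note valley = discrete_convex_on_valley[OF convex[unfolded J], folded S, folded k]
  have "unimodal_on J (\<lambda>m. exp (- F m))"
    unfolding unimodal_on_def J
  proof (intro bexI[of _ k] conjI monotone_onI)
    show "exp (- F i) \<le> exp (- F j)"
      if "i \<in> {m \<in> {0..n}. m \<le> k}" "j \<in> {m \<in> {0..n}. m \<le> k}" "i \<le> j" for i j
      using that valley(2)[of i j] by (cases "i = j") auto
    show "exp (- F j) \<le> exp (- F i)"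
      if "i \<in> {m \<in> {0..n}. k \<le> m}" "j \<in> {m \<in> {0..n}. k \<le> m}" "i \<le> j" for i j
      using that valley(3)[of i j] by simp
  qed (use valley(1) in simp)
  moreover have "is_smallest {m \<in> J. \<forall>l\<in>J. exp (- F l) \<le> exp (- F m)} k"
  proof -
    \<comment> \<open>Minimizing \<open>F\<close> is maximizing the success probability. The strict
      descent before \<open>k\<close> then excludes any earlier maximizer.\<close>
    have "F k \<le> F l" if "l \<le> n" for l
      using valley(2)[of l k] valley(3)[of k l] that by (cases "l < k") auto
    moreover have "k \<le> m" if "F m \<le> F k" for m
      using valley(2)[of m k] that by (cases "m < k") auto
    ultimately show ?thesis
      using valley(1) by (auto simp: is_smallest_def J)
  qed
  moreover have "is_smallest {m \<in> J. \<alpha> \<le> measure (Pr (h m) x) (Succ x (h m))}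
      (Min {m \<in> J. F m \<le> - ln \<alpha>})"
    if "\<alpha> \<in> {0<..<1}" "{m \<in> J. F m \<le> - ln \<alpha>} \<noteq> {}" for \<alpha>
  proof -
    \<comment> \<open>Since \<alpha> is positive, the logarithm preserves the inequality both ways;
      the two threshold sets coincide, and the finite set attains its minimum.\<close>
    have "\<alpha> \<le> exp (- F m) \<longleftrightarrow> F m \<le> - ln \<alpha>" for m
      using that(1) ln_le_cancel_iff[of \<alpha> "exp (- F m)"] by auto
    then have eq: "{m \<in> J. \<alpha> \<le> measure (Pr (h m) x) (Succ x (h m))} = {m \<in> J. F m \<le> - ln \<alpha>}"
      using succ_exp by force
    have fin: "finite {m \<in> J. F m \<le> - ln \<alpha>}"
      by (simp add: J)
    show ?thesis
      unfolding is_smallest_def eq using Min_in[OF fin that(2)] Min_le[OF fin] by blast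
  qed
  ultimately show ?thesis
    unfolding Let_def S_def[symmetric] k_def[symmetric]
    using convex succ_exp discrete_convex_on_imp_log_concave_on[OF convex] by blast
qed

end
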